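(* Let $K \geq 1$ and let $N_1, N_2, \dots, N_K \geq 1$ be given integers. Then for any $f_k \in \mathcal{L}(N_k)$ and any real $t_k > 0$, $1 \leq k \leq K$, we have the inequality $$\int_0^{2\pi} \log \left(\sum_{k=1}^K t_k|D_{N_k}(e^{i\theta})|^2 \right) d\theta \;\leq\; \int_0^{2\pi} \log \left(\sum_{k=1}^K t_k|f_{k}(e^{i\theta})|^2 \right) d\theta .$$
   Context: For each integer $N \geq 1$, $\mathcal{L}(N)$ denotes the collection of all complex polynomials $f$ of the form $f(z) = c_0 + c_1 z + c_2 z^{2} + \dots + c_{N-1} z^{N-1}$ where each $c_j \in \{1,-1\}$ (Littlewood polynomials). The polynomial $D_N \in \mathcal{L}(N)$ is defined by $D_N(z) = 1 + z + z^2 + \dots + z^{N-1}$. *)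

theory Defs
  imports "HOL-Analysis.Analysis" "HOL-Computational_Algebra.Polynomial"
begin

definition littlewood :: "nat \<Rightarrow> complex poly set" where
  "littlewood N = {\<Sum>j<N. monom (c j) j |c. \<forall>j<N. c j \<in> {1, -1}}"

definition D :: "nat \<Rightarrow> complex poly" where
  "D N = (\<Sum>j<N. monom 1 j)"

end

theory Submission
  imports Defs "HOL-Number_Theory.Cong" "Jordan_Normal_Form.Determinant"
begin

text \<open>
  Put \<open>g = (1 - z) f\<close> for a Littlewood polynomial \<open>f\<close> of length \<open>N\<close>; for \<open>f = D N\<close> this is \<open>1 - z^N\<close>,
  and in general \<open>g\<close> is congruent to \<open>1 - z^N\<close> modulo 2. The product of
  \<open>\<Sum>\<^sub>k t\<^sub>k |g\<^sub>k|\<^sup>2\<close> over the nontrivial \<open>n\<close>-th roots of unity is, up to the factor \<open>n\<close>,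
  the reduced determinant of the circulant Gram matrix of the \<open>g\<^sub>k\<close>, which by Cauchy--Binet is a
  sum of squares of integer minors with nonnegative weights. For \<open>1 - z^N\<close> the circulant is a
  directed incidence matrix, so its minors lie in \<open>{-1, 0, 1}\<close>; the corresponding minors for a
  general \<open>f\<close> have the same parity and hence are at least as large in absolute value. Dividing by
  \<open>|1 - z|\<^sup>2\<close> gives the inequality for the products over roots of unity, and \<open>n \<rightarrow> \<infinity>\<close> gives the one for
  the integrals when the integrands are continuous. Zeros on the circle are removed by adding
  \<open>\<epsilon> |D 1|\<^sup>2 = \<epsilon>\<close> to both sums and letting \<open>\<epsilon> \<rightarrow> 0\<close> by monotone convergence.
\<close>

section \<open>Gram determinants and total unimodularity\<close>

text \<open>
  Cauchy--Binet, summed over all index maps instead of subsets, so that every minor occurs \<open>n!\<close> times.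
\<close>

lemma factorial_det_weighted_gram:
  fixes v :: "'c \<Rightarrow> nat \<Rightarrow> 'a :: {comm_ring_1, ring_char_0}" and w :: "'c \<Rightarrow> 'a"
  assumes "finite S"
  shows "fact n * Determinant.det (Matrix.mat n n (\<lambda>(i, j). \<Sum>c\<in>S. w c * v c i * v c j)) =
    (\<Sum>\<phi>\<in>{0..<n} \<rightarrow>\<^sub>E S. (\<Prod>i = 0..<n. w (\<phi> i)) *
       (Determinant.det (Matrix.mat n n (\<lambda>(i, j). v (\<phi> i) j)))\<^sup>2)"
proof -
  define V where "V \<phi> = Matrix.mat n n (\<lambda>(i, j). v (\<phi> i) j)" for \<phi> :: "nat \<Rightarrow> 'c"
  define P where "P = {p. p permutes {0..<n}}"
  define F where "F = ({0..<n} \<rightarrow>\<^sub>E S)"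
  define W where "W \<phi> = (\<Prod>i = 0..<n. w (\<phi> i))" for \<phi>
  let ?G = "Determinant.det (Matrix.mat n n (\<lambda>(i, j). \<Sum>c\<in>S. w c * v c i * v c j))"
  have V: "V \<phi> \<in> carrier_mat n n" for \<phi>
    by (simp add: V_def)
  have detV: "Determinant.det (V \<phi>) = (\<Sum>p\<in>P. signof p * (\<Prod>i = 0..<n. v (\<phi> i) (p i)))" for \<phi>
    unfolding P_def
    by (subst det_def'[OF V], unfold V_def, intro sum.cong refl arg_cong2[where f = "(*)"] prod.cong)
       (auto dest: permutes_in_image)
  have detV': "Determinant.det (V \<phi>) = (\<Sum>p\<in>P. signof p * (\<Prod>i = 0..<n. v (\<phi> (p i)) i))" for \<phi>
    unfolding P_def
    by (subst mat_det_left_def[OF V], unfold V_def, intro sum.cong arg_cong2[where f = "(*)"] prod.cong)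
       (auto dest: permutes_in_image)
  have "?G = (\<Sum>p\<in>P. signof p * (\<Prod>i = 0..<n. \<Sum>c\<in>S. w c * v c i * v c (p i)))"
    unfolding Determinant.det_def P_def
    by (auto intro!: sum.cong arg_cong2[where f = "(*)"] prod.cong dest: permutes_in_image)
  also have "\<dots> = (\<Sum>p\<in>P. signof p *
      (\<Sum>\<phi>\<in>F. \<Prod>i = 0..<n. w (\<phi> i) * v (\<phi> i) i * v (\<phi> i) (p i)))"
    unfolding F_def by (subst prod_sum_PiE) (use assms in auto)
  also have "\<dots> = (\<Sum>\<phi>\<in>F. W \<phi> * (\<Prod>i = 0..<n. v (\<phi> i) i) * Determinant.det (V \<phi>))"
    unfolding detV W_def sum_distrib_left
    by (subst sum.swap) (simp add: prod.distrib mult_ac)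
  finally have G: "?G = (\<Sum>\<phi>\<in>F. W \<phi> * (\<Prod>i = 0..<n. v (\<phi> i) i) * Determinant.det (V \<phi>))" .
  \<comment> \<open>Replacing \<phi> by \<open>\<phi> \<circ> q\<close> permutes the index maps,
    fixes \<open>W\<close> and multiplies the determinant by the sign of \<open>q\<close>. This
    gives one expansion for each of the \<open>n!\<close> permutations \<open>q\<close>; their sum
    rebuilds a second determinant factor through \<open>detV'\<close>.\<close>
  have Gq: "?G = (\<Sum>\<phi>\<in>F. W \<phi> * Determinant.det (V \<phi>) * (signof q * (\<Prod>i = 0..<n. v (\<phi> (q i)) i)))"
    if "q \<in> P" for q
  proof -
    have q: "q permutes {0..<n}"
      using that by (simp add: P_def)
    have "?G = (\<Sum>\<phi>\<in>F. W (\<phi> \<circ> q) * (\<Prod>i = 0..<n. v ((\<phi> \<circ> q) i) i) * Determinant.det (V (\<phi> \<circ> q)))"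
      unfolding G
    proof (rule sum.reindex_bij_witness[where i = "\<lambda>\<phi>. \<phi> \<circ> q" and j = "\<lambda>\<phi>. \<phi> \<circ> Hilbert_Choice.inv q"])
      fix \<phi> assume \<phi>: "\<phi> \<in> F"
      show "\<phi> \<circ> q \<in> F"
        using \<phi> permutes_in_image[OF q] by (auto simp: F_def PiE_iff extensional_def)
      show "\<phi> \<circ> Hilbert_Choice.inv q \<in> F"
        using \<phi> permutes_in_image[OF permutes_inv[OF q]] by (auto simp: F_def PiE_iff extensional_def)
    qed (auto simp: o_assoc[symmetric] permutes_inv_o[OF q])
    also have "\<dots> = (\<Sum>\<phi>\<in>F. W \<phi> * Determinant.det (V \<phi>) * (signof q * (\<Prod>i = 0..<n. v (\<phi> (q i)) i)))"
    proof (rule sum.cong[OF refl])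
      fix \<phi>
      have "W (\<phi> \<circ> q) = W \<phi>"
        unfolding W_def using prod.permute[OF q, of "\<lambda>i. w (\<phi> i)"] by (simp add: o_def)
      moreover have "Matrix.mat n n (\<lambda>(i, j). V \<phi> $$ (q i, j)) = V (\<phi> \<circ> q)"
        using permutes_in_image[OF q] by (intro eq_matI) (auto simp: V_def)
      then have "Determinant.det (V (\<phi> \<circ> q)) = signof q * Determinant.det (V \<phi>)"
        using det_permute_rows[OF V q, of \<phi>] by simp
      ultimately show "W (\<phi> \<circ> q) * (\<Prod>i = 0..<n. v ((\<phi> \<circ> q) i) i) * Determinant.det (V (\<phi> \<circ> q)) =
          W \<phi> * Determinant.det (V \<phi>) * (signof q * (\<Prod>i = 0..<n. v (\<phi> (q i)) i))"
        by (simp add: mult_ac)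
    qed
    finally show ?thesis .
  qed
  have "fact n * ?G = (\<Sum>q\<in>P. ?G)"
    by (simp add: P_def card_permutations)
  also have "\<dots> = (\<Sum>q\<in>P. \<Sum>\<phi>\<in>F. W \<phi> * Determinant.det (V \<phi>) * (signof q * (\<Prod>i = 0..<n. v (\<phi> (q i)) i)))"
    by (rule sum.cong[OF refl Gq])
  also have "\<dots> = (\<Sum>\<phi>\<in>F. W \<phi> * (Determinant.det (V \<phi>))\<^sup>2)"
    by (subst sum.swap) (simp add: sum_distrib_left[symmetric] detV'[symmetric] power2_eq_square mult.assoc)
  finally show ?thesis
    by (simp add: F_def W_def V_def)
qed

text \<open>
  An index \<open>a \<ge> n\<close> or \<open>b \<ge> n\<close> stands for an absent entry, which makes the hypothesis stable under
  deleting rows and columns.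
\<close>

lemma det_incidence_rows:
  fixes A :: "int mat"
  assumes "A \<in> carrier_mat n n"
    and "\<And>i. i < n \<Longrightarrow> \<exists>a b. \<forall>j<n. A $$ (i, j) = of_bool (j = a) - of_bool (j = b)"
  shows "\<bar>Determinant.det A\<bar> \<le> 1"
  using assms
proof (induction n arbitrary: A)
  case 0
  then show ?case by simp
next
  case (Suc n)
  note A = Suc.prems(1)
  have cof: "\<bar>cofactor A i c\<bar> \<le> 1" if i: "i < Suc n" and c: "c < Suc n" for i c
  proof -
    have "\<bar>Determinant.det (mat_delete A i c)\<bar> \<le> 1"
    proof (rule Suc.IH)
      show "mat_delete A i c \<in> carrier_mat n n"
        using mat_delete_carrier[OF A] by simp
      fix r assume r: "r < n"
      define r' where "r' = (if r < i then r else Suc r)"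
      have "r' < Suc n"
        using r by (simp add: r'_def)
      from Suc.prems(2)[OF this] obtain a b where
        ab: "\<And>j. j < Suc n \<Longrightarrow> A $$ (r', j) = of_bool (j = a) - of_bool (j = b)"
        by blast
      \<comment> \<open>Renumbering after the deletion of column \<open>c\<close>: an entry in that
        column is sent to \<open>n\<close>, outside the remaining \<open>n\<close> columns, and so
        counts as absent.\<close>
      define \<delta> where "\<delta> x = (if x < c then x else if x = c then n else x - 1)" for x
      have \<delta>: "(if j < c then j else Suc j) = x \<longleftrightarrow> j = \<delta> x" if "j < n" for j x
        using that c by (auto simp: \<delta>_def)
      show "\<exists>a b. \<forall>j<n. mat_delete A i c $$ (r, j) = of_bool (j = a) - of_bool (j = b)"
      proof (intro exI allI impI)
        fix j assume j: "j < n"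
        have "mat_delete A i c $$ (r, j) = A $$ (r', if j < c then j else Suc j)"
          using A r j by (simp add: mat_delete_def r'_def)
        also have "\<dots> = of_bool (j = \<delta> a) - of_bool (j = \<delta> b)"
          using j by (subst ab) (auto simp: \<delta>[OF j])
        finally show "mat_delete A i c $$ (r, j) = of_bool (j = \<delta> a) - of_bool (j = \<delta> b)" .
      qed
    qed
    then show ?thesis
      by (simp add: cofactor_def abs_mult)
  qed
  show ?case
  proof (cases "\<exists>i<Suc n. \<exists>a b. (\<forall>j<Suc n. A $$ (i, j) = of_bool (j = a) - of_bool (j = b)) \<and> (a \<ge> Suc n \<or> b \<ge> Suc n)")
    case True
    then obtain i a b where i: "i < Suc n"
      and ab: "\<And>j. j < Suc n \<Longrightarrow> A $$ (i, j) = of_bool (j = a) - of_bool (j = b)"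
      and out: "a \<ge> Suc n \<or> b \<ge> Suc n"
      by blast
    \<comment> \<open>With one of the two entries absent, at most one cofactor survives.\<close>
    have "Determinant.det A = (\<Sum>j<Suc n. A $$ (i, j) * cofactor A i j)"
      by (rule laplace_expansion_row[OF A i])
    also have "\<dots> = (\<Sum>j<Suc n. of_bool (j = a) * cofactor A i j) - (\<Sum>j<Suc n. of_bool (j = b) * cofactor A i j)"
      unfolding sum_subtractf[symmetric] by (intro sum.cong) (auto simp: ab)
    also have "\<dots> = (if a < Suc n then cofactor A i a else 0) - (if b < Suc n then cofactor A i b else 0)"
      by (simp add: of_bool_def if_distrib[of "\<lambda>x. x * _"] sum.delta cong: if_cong del: sum.lessThan_Suc)
    finally show ?thesis
      using out cof[OF i] by auto
  next
    case False
    \<comment> \<open>Now every row has its \<open>1\<close> and its \<open>-1\<close> inside the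
      matrix, so it sums to zero and the all-ones vector lies in the kernel.\<close>
    have "A *\<^sub>v Matrix.vec (Suc n) (\<lambda>_. 1) = 0\<^sub>v (Suc n)"
    proof (rule eq_vecI)
      fix i assume "i < dim_vec (0\<^sub>v (Suc n) :: int vec)"
      then have i: "i < Suc n" by simp
      from Suc.prems(2)[OF i] obtain a b where
        ab: "\<And>j. j < Suc n \<Longrightarrow> A $$ (i, j) = of_bool (j = a) - of_bool (j = b)"
        by blast
      with False i have "\<not> (a \<ge> Suc n \<or> b \<ge> Suc n)"
        by blast
      then have "a < Suc n" "b < Suc n"
        by auto
      have "vec_index (A *\<^sub>v Matrix.vec (Suc n) (\<lambda>_. 1)) i = (\<Sum>j = 0..<Suc n. A $$ (i, j))"
        using A i by (simp add: scalar_prod_def del: sum.op_ivl_Suc)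
      also have "\<dots> = (\<Sum>j = 0..<Suc n. of_bool (j = a)) - (\<Sum>j = 0..<Suc n. of_bool (j = b))"
        unfolding sum_subtractf[symmetric] by (intro sum.cong) (auto simp: ab)
      also have "\<dots> = 0"
        using \<open>a < Suc n\<close> \<open>b < Suc n\<close> by (simp add: of_bool_def sum.delta del: sum.op_ivl_Suc)
      finally show "vec_index (A *\<^sub>v Matrix.vec (Suc n) (\<lambda>_. 1)) i = vec_index (0\<^sub>v (Suc n)) i"
        using i by simp
    qed (use A in simp)
    moreover have "Matrix.vec (Suc n) (\<lambda>_. 1 :: int) \<noteq> 0\<^sub>v (Suc n)"
      by (metis index_vec index_zero_vec(1) zero_less_Suc zero_neq_one)
    ultimately have "Determinant.det A = 0"
      unfolding det_0_iff_vec_prod_zero[OF A] by (metis vec_carrier)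
    then show ?thesis by simp
  qed
qed

lemma det_cong_int:
  fixes A B :: "int mat"
  assumes "A \<in> carrier_mat n n" "B \<in> carrier_mat n n"
    and "\<And>i j. i < n \<Longrightarrow> j < n \<Longrightarrow> [A $$ (i, j) = B $$ (i, j)] (mod m)"
  shows "[Determinant.det A = Determinant.det B] (mod m)"
  unfolding det_def'[OF assms(1)] det_def'[OF assms(2)]
  by (intro cong_sum cong_mult cong_prod cong_refl assms(3)) (auto dest: permutes_in_image)

text \<open>By Cauchy--Binet it suffices to compare squared minors, the weights being nonnegative. A
  minor of \<open>u\<close> is \<open>0\<close>, \<open>1\<close> or \<open>-1\<close>; if nonzero
  it is odd, hence so is the minor of \<open>v\<close>, which then has absolute value at least
  \<open>1\<close>.\<close>

lemma det_weighted_gram_mono: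
  fixes u v :: "'c \<Rightarrow> nat \<Rightarrow> int" and w :: "'c \<Rightarrow> real"
  assumes "finite S" and w: "\<And>c. c \<in> S \<Longrightarrow> w c \<ge> 0"
    and inc: "\<And>c. c \<in> S \<Longrightarrow> \<exists>a b. \<forall>j<n. u c j = of_bool (j = a) - of_bool (j = b)"
    and par: "\<And>c j. c \<in> S \<Longrightarrow> j < n \<Longrightarrow> [u c j = v c j] (mod 2)"
  shows "Determinant.det (Matrix.mat n n (\<lambda>(i, j). \<Sum>c\<in>S. w c * of_int (u c i) * of_int (u c j)))
       \<le> Determinant.det (Matrix.mat n n (\<lambda>(i, j). \<Sum>c\<in>S. w c * of_int (v c i) * of_int (v c j)))"
    (is "?du \<le> ?dv")
proof -
  define M where "M x \<phi> = Matrix.mat n n (\<lambda>(i, j). x (\<phi> i) j)" for x :: "'c \<Rightarrow> nat \<Rightarrow> int" and \<phi> :: "nat \<Rightarrow> 'c"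
  have M: "M x \<phi> \<in> carrier_mat n n" for x \<phi>
    by (simp add: M_def)
  have real: "Determinant.det (Matrix.mat n n (\<lambda>(i, j). of_int (x (\<phi> i) j))) = (of_int (Determinant.det (M x \<phi>)) :: real)" for x \<phi>
    unfolding of_int_hom.hom_det[symmetric]
    by (rule arg_cong[where f = Determinant.det]) (auto simp: M_def)
  have "(Determinant.det (M u \<phi>))\<^sup>2 \<le> (Determinant.det (M v \<phi>))\<^sup>2" if \<phi>: "\<phi> \<in> {0..<n} \<rightarrow>\<^sub>E S" for \<phi>
  proof -
    have small: "\<bar>Determinant.det (M u \<phi>)\<bar> \<le> 1"
    proof (rule det_incidence_rows[OF M])
      show "\<exists>a b. \<forall>j<n. M u \<phi> $$ (i, j) = of_bool (j = a) - of_bool (j = b)" if "i < n" for i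
        using \<phi> that inc[of "\<phi> i"] by (simp add: M_def PiE_iff del: of_bool_eq_iff)
    qed
    then have "-1 \<le> Determinant.det (M u \<phi>)" "Determinant.det (M u \<phi>) \<le> 1"
      by linarith+
    moreover have "[Determinant.det (M u \<phi>) = Determinant.det (M v \<phi>)] (mod 2)"
      using \<phi> by (intro det_cong_int[OF M M]) (auto simp: M_def PiE_iff intro!: par)
    ultimately have "Determinant.det (M u \<phi>) = 0 \<or> Determinant.det (M v \<phi>) \<noteq> 0"
      unfolding cong_def by presburger
    with small have "\<bar>Determinant.det (M u \<phi>)\<bar> \<le> \<bar>Determinant.det (M v \<phi>)\<bar>"
      by linarith
    then show ?thesis
      by (simp add: abs_le_square_iff)
  qed
  then have "fact n * ?du \<le> fact n * ?dv"
    unfolding factorial_det_weighted_gram[OF \<open>finite S\<close>, of n w "\<lambda>c j. of_int (u c j)"]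
      factorial_det_weighted_gram[OF \<open>finite S\<close>, of n w "\<lambda>c j. of_int (v c j)"] real
    by (intro sum_mono mult_left_mono prod_nonneg)
      (auto simp: PiE_iff simp del: of_int_power simp: of_int_power[symmetric] intro!: w)
  then show ?thesis
    by (simp add: mult_le_cancel_left)
qed

section \<open>Circulant matrices\<close>

definition unity_root :: "nat \<Rightarrow> nat \<Rightarrow> complex" where
  "unity_root n j = cis (2 * pi * real j / real n)"

lemma unity_root_0 [simp]: "unity_root n 0 = 1"
  by (simp add: unity_root_def)

lemma norm_unity_root [simp]: "cmod (unity_root n j) = 1"
  by (simp add: unity_root_def)

lemma unity_root_power_swap: "unity_root n i ^ j = unity_root n j ^ i"
  by (simp add: unity_root_def Complex.DeMoivre mult_ac)

lemma unity_root_power_n: "n > 0 \<Longrightarrow> unity_root n j ^ n = 1"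
  using cis_multiple_2pi[of "real j"] by (simp add: unity_root_def Complex.DeMoivre)

lemma unity_root_eq_iff:
  assumes "i < n" "j < n"
  shows "unity_root n i = unity_root n j \<longleftrightarrow> i = j"
  using bij_betw_imp_inj_on[OF Complex.bij_betw_roots_unity[of n]] assms
  by (auto simp: unity_root_def inj_on_def)

lemma sum_power_root_of_unity:
  fixes x :: complex
  assumes "x ^ n = 1"
  shows "(\<Sum>l<n. x ^ l) = (if x = 1 then of_nat n else 0)"
  using assms by (simp add: geometric_sum)

lemma sum_unity_root_power:
  assumes "i < n"
  shows "(\<Sum>l<n. unity_root n l ^ i) = of_nat n * of_bool (i = 0)"
proof -
  have "(\<Sum>l<n. unity_root n l ^ i) = (\<Sum>l<n. unity_root n i ^ l)"
    by (intro sum.cong refl unity_root_power_swap)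
  also have "\<dots> = of_nat n * of_bool (i = 0)"
    using assms unity_root_eq_iff[of i n 0]
    by (subst sum_power_root_of_unity) (auto simp: unity_root_power_n)
  finally show ?thesis .
qed

definition fourier_mat :: "nat \<Rightarrow> complex mat" where
  "fourier_mat n = Matrix.mat n n (\<lambda>(i, j). unity_root n j ^ i)"

lemma det_fourier_mat_nonzero: "Determinant.det (fourier_mat n) \<noteq> 0"
proof (cases "n = 0")
  case False
  \<comment> \<open>The conjugate transpose; the rows of the Fourier matrix are orthogonal.\<close>
  define H where "H = Matrix.mat n n (\<lambda>(i, j). cnj (unity_root n i) ^ j)"
  have "fourier_mat n * H = of_nat n \<cdot>\<^sub>m 1\<^sub>m n"
  proof (rule eq_matI)
    fix i j assume "i < dim_row (of_nat n \<cdot>\<^sub>m 1\<^sub>m n :: complex mat)" "j < dim_col (of_nat n \<cdot>\<^sub>m 1\<^sub>m n :: complex mat)"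
    then have ij: "i < n" "j < n" by auto
    define x where "x = unity_root n i * cnj (unity_root n j)"
    have "x ^ n = 1"
      using False by (simp add: x_def power_mult_distrib unity_root_power_n flip: complex_cnj_power)
    have "x = 1 \<longleftrightarrow> unity_root n i = unity_root n j"
    proof
      assume "x = 1"
      then have "unity_root n i * (cnj (unity_root n j) * unity_root n j) = unity_root n j"
        by (simp add: x_def mult.assoc[symmetric])
      then show "unity_root n i = unity_root n j"
        by (simp add: mult.commute[of "cnj _"] complex_norm_square[symmetric])
    qed (simp add: x_def complex_norm_square[symmetric])
    then have x1: "x = 1 \<longleftrightarrow> i = j"
      using ij by (simp add: unity_root_eq_iff)
    have "(fourier_mat n * H) $$ (i, j) = (\<Sum>l<n. unity_root n l ^ i * cnj (unity_root n l ^ j))"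
      using ij by (simp add: fourier_mat_def H_def scalar_prod_def atLeast0LessThan)
    also have "\<dots> = (\<Sum>l<n. x ^ l)"
      by (simp add: x_def power_mult_distrib unity_root_power_swap[of n _ i] unity_root_power_swap[of n _ j])
    finally show "(fourier_mat n * H) $$ (i, j) = (of_nat n \<cdot>\<^sub>m 1\<^sub>m n) $$ (i, j)"
      using ij x1 by (simp add: sum_power_root_of_unity[OF \<open>x ^ n = 1\<close>])
  qed (simp_all add: fourier_mat_def H_def)
  then have "Determinant.det (fourier_mat n * H) \<noteq> 0"
    using False by simp
  then show ?thesis
    by (subst (asm) Determinant.det_mult[of _ n]) (auto simp: fourier_mat_def H_def)
qed (simp add: fourier_mat_def)

text \<open>Row \<open>s\<close> holds the coefficients of \<open>z^s \<Sum>\<^sub>m b\<^sub>m z^m\<close> reduced modulo \<open>z^n - 1\<close>.\<close>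

definition circ :: "nat \<Rightarrow> nat \<Rightarrow> (nat \<Rightarrow> int) \<Rightarrow> nat \<Rightarrow> nat \<Rightarrow> int" where
  "circ n M b s i = (\<Sum>m\<le>M. b m * of_bool ((s + m) mod n = i))"

lemma circ_row_sum:
  fixes z :: complex
  assumes "n > 0" "z ^ n = 1"
  shows "(\<Sum>i<n. of_int (circ n M b s i) * z ^ i) = z ^ s * (\<Sum>m\<le>M. of_int (b m) * z ^ m)"
proof -
  have z: "z ^ (k mod n) = z ^ k" for k
    by (metis assms(2) div_mult_mod_eq mult.commute mult_1 power_add power_mult power_one)
  have "(\<Sum>i<n. of_int (circ n M b s i) * z ^ i) =
      (\<Sum>m\<le>M. of_int (b m) * (\<Sum>i<n. of_bool ((s + m) mod n = i) * z ^ i))"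
    unfolding circ_def of_int_sum sum_distrib_left sum_distrib_right
    by (subst sum.swap) (simp add: mult.assoc)
  also have "\<dots> = (\<Sum>m\<le>M. of_int (b m) * z ^ (s + m))"
    using assms(1)
    by (intro sum.cong refl arg_cong2[where f = "(*)"])
      (simp add: of_bool_def if_distrib[of "\<lambda>x. x * _"] sum.delta' z cong: if_cong)
  finally show ?thesis
    by (simp add: sum_distrib_left power_add mult_ac)
qed

lemma bij_betw_add_mod: "n > 0 \<Longrightarrow> bij_betw (\<lambda>s. (s + m) mod n) {..<n} {..<n :: nat}"
  unfolding bij_betw_def
proof (intro conjI endo_inj_surj)
  show "inj_on (\<lambda>s. (s + m) mod n) {..<n}"
    by (auto simp: inj_on_def cong_add_rcancel_nat simp flip: cong_def) (simp add: cong_def)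
  then show "inj_on (\<lambda>s. (s + m) mod n) {..<n}" .
qed auto

text \<open>For fixed \<open>m\<close> exactly one row \<open>s < n\<close> hits column
  \<open>i\<close>, and there \<open>z ^ s = z ^ i * cnj z ^ m\<close> because \<open>cnj z\<close>
  is the inverse of \<open>z\<close>. Together with the row sums this makes the squared moduli
  eigenvalues of the Gram matrix.\<close>

lemma circ_col_sum:
  fixes z :: complex
  assumes n: "n > 0" and z: "z ^ n = 1" and i: "i < n"
  shows "(\<Sum>s<n. of_int (circ n M b s i) * z ^ s) = z ^ i * cnj (\<Sum>m\<le>M. of_int (b m) * z ^ m)"
proof -
  have zmod: "z ^ (k mod n) = z ^ k" for k
    by (metis z div_mult_mod_eq mult.commute mult_1 power_add power_mult power_one)
  have "cmod z = 1"
    using z n by (metis norm_ge_zero norm_one norm_power power_eq_1_iff zero_less_iff_neq_zero abs_norm_cancel)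
  then have unit: "z * cnj z = 1"
    by (simp add: complex_norm_square[symmetric])
  have shift: "of_bool ((s + m) mod n = i) * z ^ s = z ^ i * cnj z ^ m * of_bool ((s + m) mod n = i)" for s m
  proof (cases "(s + m) mod n = i")
    case True
    then have "z ^ i * cnj z ^ m = z ^ s * (z * cnj z) ^ m"
      using zmod[of "s + m"] by (simp add: power_add power_mult_distrib)
    with True unit show ?thesis by simp
  qed simp
  have one: "(\<Sum>s<n. of_bool ((s + m) mod n = i)) = (1 :: complex)" for m
    using sum.reindex_bij_betw[OF bij_betw_add_mod[OF n, of m], of "\<lambda>r. of_bool (r = i) :: complex"] i
    by (simp add: of_bool_def sum.delta)
  have "(\<Sum>s<n. of_int (circ n M b s i) * z ^ s) =
      (\<Sum>m\<le>M. of_int (b m) * (\<Sum>s<n. of_bool ((s + m) mod n = i) * z ^ s))"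
    unfolding circ_def of_int_sum sum_distrib_left sum_distrib_right
    by (subst sum.swap) (simp add: mult.assoc)
  also have "\<dots> = (\<Sum>m\<le>M. of_int (b m) * (z ^ i * cnj z ^ m))"
    unfolding shift sum_distrib_left[symmetric] one by simp
  finally show ?thesis
    by (simp add: sum_distrib_left mult_ac)
qed

text \<open>
  The Fourier matrix \<open>F\<close> diagonalizes the circulant part, and the first unit vector is \<open>F\<close> applied
  to the constant vector \<open>1/n\<close>. So the matrix is conjugate to \<open>diag(\<lambda>)\<close> plus the constant matrix
  \<open>1/n\<close>, whose triangular factorization \<open>L U\<close> is explicit because \<open>\<lambda>\<^sub>0 = 0\<close>.
\<close>

lemma det_grounded_circulant_gram:
  fixes t :: "'k \<Rightarrow> real" and b :: "'k \<Rightarrow> nat \<Rightarrow> int" and M :: "'k \<Rightarrow> nat"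
  assumes n: "n > 0" and zero: "\<And>k. k \<in> I \<Longrightarrow> (\<Sum>m\<le>M k. b k m) = 0"
  shows "of_nat n * Determinant.det (Matrix.mat n n (\<lambda>(i, j).
      (\<Sum>k\<in>I. \<Sum>s<n. t k * of_int (circ n (M k) (b k) s i) * of_int (circ n (M k) (b k) s j))
        + of_bool (i = 0 \<and> j = 0)))
    = (\<Prod>j = 1..<n. \<Sum>k\<in>I. t k * (cmod (\<Sum>m\<le>M k. of_int (b k m) * unity_root n j ^ m))\<^sup>2)"
    (is "of_nat n * Determinant.det ?A = prod ?ev _")
proof -
  define Ac where "Ac = map_mat complex_of_real ?A"
  define F where "F = fourier_mat n"
  define L where "L = Matrix.mat n n (\<lambda>(i, j). of_bool (j = 0 \<or> i = j) :: complex)"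
  define U where "U = Matrix.mat n n (\<lambda>(i, j). if i = 0 then 1 / of_nat n else if i = j then complex_of_real (?ev i) else 0)"
  define C where "C k s i = complex_of_int (circ n (M k) (b k) s i)" for k s i
  define z where "z = unity_root n"
  define B where "B k x = (\<Sum>m\<le>M k. complex_of_int (b k m) * x ^ m)" for k x
  have carrier: "Ac \<in> carrier_mat n n" "F \<in> carrier_mat n n" "L \<in> carrier_mat n n" "U \<in> carrier_mat n n"
    by (auto simp: Ac_def F_def L_def U_def fourier_mat_def)
  have lambda0: "?ev 0 = 0"
    using zero by (auto intro!: sum.neutral simp flip: of_int_sum)
  \<comment> \<open>Column \<open>j\<close> of \<open>F\<close> is an eigenvector of the circulant
    part with eigenvalue \<open>?ev j\<close>; the additional corner entry meets
    \<open>z j ^ 0 = 1\<close> and adds the first unit vector.\<close>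
  have AF: "(Ac * F) $$ (i, j) = ?ev j * z j ^ i + of_bool (i = 0)" if "i < n" "j < n" for i j
  proof -
    have zn: "z j ^ n = 1"
      using n by (simp add: z_def unity_root_power_n)
    have "(Ac * F) $$ (i, j) = (\<Sum>l<n. ((\<Sum>k\<in>I. \<Sum>s<n. t k * C k s i * C k s l) + of_bool (i = 0 \<and> l = 0)) * z j ^ l)"
      using that by (simp add: Ac_def F_def fourier_mat_def C_def z_def scalar_prod_def atLeast0LessThan
          of_bool_def if_distrib[of complex_of_real] cong: if_cong)
    also have "\<dots> = (\<Sum>l<n. (\<Sum>k\<in>I. \<Sum>s<n. t k * C k s i * C k s l) * z j ^ l) + (\<Sum>l<n. of_bool (i = 0 \<and> l = 0) * z j ^ l)"
      by (simp add: ring_distribs sum.distrib)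
    also have "(\<Sum>l<n. of_bool (i = 0 \<and> l = 0) * z j ^ l) = (\<Sum>l\<in>{0}. of_bool (i = 0 \<and> l = 0) * z j ^ l)"
      using n by (intro sum.mono_neutral_right) auto
    also have "\<dots> = of_bool (i = 0)"
      by simp
    also have "(\<Sum>l<n. (\<Sum>k\<in>I. \<Sum>s<n. t k * C k s i * C k s l) * z j ^ l)
        = (\<Sum>l<n. \<Sum>k\<in>I. \<Sum>s<n. t k * C k s i * (C k s l * z j ^ l))"
      by (simp add: sum_distrib_left sum_distrib_right mult_ac)
    also have "\<dots> = (\<Sum>k\<in>I. \<Sum>l<n. \<Sum>s<n. t k * C k s i * (C k s l * z j ^ l))"
      by (rule sum.swap)
    also have "\<dots> = (\<Sum>k\<in>I. \<Sum>s<n. \<Sum>l<n. t k * C k s i * (C k s l * z j ^ l))"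
      by (intro sum.cong refl sum.swap)
    also have "\<dots> = (\<Sum>k\<in>I. \<Sum>s<n. t k * C k s i * (z j ^ s * B k (z j)))"
      unfolding sum_distrib_left[symmetric] C_def circ_row_sum[OF n zn] B_def ..
    also have "\<dots> = (\<Sum>k\<in>I. t k * B k (z j) * (\<Sum>s<n. C k s i * z j ^ s))"
      by (simp add: sum_distrib_left mult_ac)
    also have "\<dots> = (\<Sum>k\<in>I. t k * (B k (z j) * cnj (B k (z j))) * z j ^ i)"
      unfolding C_def circ_col_sum[OF n zn \<open>i < n\<close>] B_def by (simp add: mult_ac)
    also have "\<dots> = ?ev j * z j ^ i"
      unfolding complex_norm_square[symmetric] B_def z_def by (simp add: sum_distrib_right)
    finally show ?thesis .
  qed
  \<comment> \<open>Only \<open>r = 0\<close> and \<open>r = l\<close> contribute. For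
    \<open>l = 0\<close> they coincide, and \<open>lambda0\<close> accounts for the missing diagonal
    term.\<close>
  have LU: "(L * U) $$ (l, j) = 1 / of_nat n + of_bool (l = j) * ?ev l" if "l < n" "j < n" for l j
  proof -
    have "(L * U) $$ (l, j) = (\<Sum>r<n. of_bool (r = 0 \<or> l = r) * U $$ (r, j))"
      using that carrier by (simp add: L_def scalar_prod_def atLeast0LessThan)
    also have "\<dots> = (\<Sum>r\<in>{0, l}. U $$ (r, j))"
      using that n by (intro sum.mono_neutral_cong_right) auto
    also have "\<dots> = 1 / of_nat n + of_bool (l = j) * ?ev l"
      using that n lambda0 by (cases "l = 0") (auto simp: U_def)
    finally show ?thesis .
  qed
  have "Ac * F = F * (L * U)"
  proof (rule eq_matI)
    fix i j assume "i < dim_row (F * (L * U))" "j < dim_col (F * (L * U))"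
    then have ij: "i < n" "j < n"
      using carrier by auto
    have "(F * (L * U)) $$ (i, j) = (\<Sum>l<n. z l ^ i * (L * U) $$ (l, j))"
      using ij carrier by (simp add: F_def fourier_mat_def z_def scalar_prod_def atLeast0LessThan)
    also have "\<dots> = (\<Sum>l<n. z l ^ i * (1 / of_nat n) + (if l = j then z l ^ i * ?ev l else 0))"
      using ij by (intro sum.cong) (auto simp: LU ring_distribs)
    also have "\<dots> = (\<Sum>l<n. z l ^ i) * (1 / of_nat n) + z j ^ i * ?ev j"
      using ij by (simp add: sum.distrib sum_divide_distrib sum.delta)
    also have "(\<Sum>l<n. z l ^ i) * (1 / of_nat n) = of_bool (i = 0)"
      using ij n by (simp add: z_def sum_unity_root_power)
    finally show "(Ac * F) $$ (i, j) = (F * (L * U)) $$ (i, j)"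
      using ij by (simp add: AF)
  qed (use carrier in auto)
  then have "Determinant.det Ac * Determinant.det F = Determinant.det F * (Determinant.det L * Determinant.det U)"
    using carrier by (metis Determinant.det_mult mult_carrier_mat)
  then have "Determinant.det Ac = Determinant.det L * Determinant.det U"
    using det_fourier_mat_nonzero[of n] by (simp add: F_def mult.commute)
  moreover have "Determinant.det L = 1"
    by (subst Determinant.det_lower_triangular[OF _ carrier(3)])
      (auto simp: L_def prod_list_diag_prod)
  \<comment> \<open>On the diagonal of \<open>U\<close> the corner entry \<open>1 / n\<close> stands
    in place of the eigenvalue \<open>0\<close>, which leaves the product over the nontrivial
    roots.\<close>
  moreover have "of_nat n * Determinant.det U = complex_of_real (prod ?ev {1..<n})"
  proof -
    have "Determinant.det U = (\<Prod>i = 0..<n. U $$ (i, i))"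
      using carrier by (subst Determinant.det_upper_triangular[OF _ carrier(4)])
        (auto simp: U_def prod_list_diag_prod)
    also have "\<dots> = U $$ (0, 0) * (\<Prod>i = 1..<n. U $$ (i, i))"
      using n by (subst prod.atLeast_Suc_lessThan) auto
    also have "(\<Prod>i = 1..<n. U $$ (i, i)) = (\<Prod>i = 1..<n. complex_of_real (?ev i))"
      by (intro prod.cong) (auto simp: U_def)
    also have "U $$ (0, 0) = 1 / of_nat n"
      using n by (simp add: U_def)
    finally show ?thesis
      using n by simp
  qed
  moreover have "Determinant.det Ac = complex_of_real (Determinant.det ?A)"
    unfolding Ac_def by (rule of_real_hom.hom_det)
  ultimately have "complex_of_real (of_nat n * Determinant.det ?A) = complex_of_real (prod ?ev {1..<n})"
    by simp
  then show ?thesis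
    by (simp only: of_real_eq_iff)
qed

section \<open>Multiplication by \<open>1 - z\<close> and products over roots of unity\<close>

text \<open>The coefficients of \<open>1 - z\<close> times \<open>\<Sum>m<N. c m * z ^ m\<close>,
  intended for \<open>m \<le> N\<close>; the guard \<open>m < N\<close> drops the unshifted term at
  the top index.\<close>

definition diff_coeff :: "nat \<Rightarrow> (nat \<Rightarrow> int) \<Rightarrow> nat \<Rightarrow> int" where
  "diff_coeff N c m = (if m < N then c m else 0) - (if m = 0 then 0 else c (m - 1))"

lemma sum_diff_coeff:
  fixes z :: "'a :: comm_ring_1"
  shows "(\<Sum>m\<le>N. of_int (diff_coeff N c m) * z ^ m) = (1 - z) * (\<Sum>m<N. of_int (c m) * z ^ m)"
proof -
  have "(\<Sum>m\<le>N. of_int (if m < N then c m else 0) * z ^ m) = (\<Sum>m<N. of_int (c m) * z ^ m)"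
    by (intro sum.mono_neutral_cong_right) auto
  moreover have "(\<Sum>m\<le>N. of_int (if m = 0 then 0 else c (m - 1)) * z ^ m) = z * (\<Sum>m<N. of_int (c m) * z ^ m)"
    by (simp add: sum.atMost_shift sum_distrib_left mult_ac)
  ultimately show ?thesis
    by (simp add: diff_coeff_def algebra_simps sum_subtractf)
qed

text \<open>For constant coefficients the differences telescope to \<open>1 - z ^ N\<close>, so each
  row is that of a directed edge between residues modulo \<open>n\<close>; if \<open>n\<close>
  divides \<open>N\<close>, its two entries cancel.\<close>

lemma circ_diff_coeff_one:
  assumes "N \<ge> 1"
  shows "circ n N (diff_coeff N (\<lambda>_. 1)) s i = of_bool (i = s mod n) - of_bool (i = (s + N) mod n)"
proof -
  have "circ n N (diff_coeff N (\<lambda>_. 1)) s i =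
      (\<Sum>m\<le>N. (if m = 0 then of_bool (i = s mod n) else 0) - (if m = N then of_bool (i = (s + N) mod n) else 0))"
    unfolding circ_def using assms by (intro sum.cong) (auto simp: diff_coeff_def)
  also have "\<dots> = of_bool (i = s mod n) - of_bool (i = (s + N) mod n)"
    by (simp add: sum_subtractf sum.delta)
  finally show ?thesis .
qed

lemma circ_cong:
  assumes "\<And>m. m \<le> M \<Longrightarrow> [b m = b' m] (mod p)"
  shows "[circ n M b s i = circ n M b' s i] (mod p)"
  unfolding circ_def by (intro cong_sum cong_mult cong_refl assms) auto

text \<open>Multiplying the polynomials by \<open>1 - z\<close> changes both products by the same
  positive factor \<open>Q\<close>. The new polynomials vanish at \<open>1\<close>, so their plain
  Gram determinant would be \<open>0\<close>; an additional row with a single \<open>1\<close> in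
  column \<open>0\<close> repairs this and is again of incidence form.\<close>

lemma prod_unity_roots_mono:
  fixes t :: "'k \<Rightarrow> real" and N :: "'k \<Rightarrow> nat" and c :: "'k \<Rightarrow> nat \<Rightarrow> int"
  assumes n: "n > 0" and I: "finite I"
    and t: "\<And>k. k \<in> I \<Longrightarrow> t k \<ge> 0" and N: "\<And>k. k \<in> I \<Longrightarrow> N k \<ge> 1"
    and c: "\<And>k m. k \<in> I \<Longrightarrow> m < N k \<Longrightarrow> odd (c k m)"
  shows "(\<Prod>j = 1..<n. \<Sum>k\<in>I. t k * (cmod (\<Sum>m<N k. unity_root n j ^ m))\<^sup>2)
       \<le> (\<Prod>j = 1..<n. \<Sum>k\<in>I. t k * (cmod (\<Sum>m<N k. of_int (c k m) * unity_root n j ^ m))\<^sup>2)"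
proof -
  \<comment> \<open>\<open>None\<close> labels the additional row, \<open>Some (k, s)\<close> row
    \<open>s\<close> of the circulant of \<open>k\<close>.\<close>
  define S where "S = insert None (Some ` (I \<times> {..<n}))"
  define w where "w x = (case x of None \<Rightarrow> 1 | Some (k, s) \<Rightarrow> t k)" for x :: "('k \<times> nat) option"
  define V where "V c x i = (case x of None \<Rightarrow> of_bool (i = 0)
      | Some (k, s) \<Rightarrow> circ n (N k) (diff_coeff (N k) (c k)) s i)"
    for c :: "'k \<Rightarrow> nat \<Rightarrow> int" and x :: "('k \<times> nat) option" and i :: nat
  define P where "P c = (\<Prod>j = 1..<n. \<Sum>k\<in>I. t k * (cmod (\<Sum>m<N k. of_int (c k m) * unity_root n j ^ m))\<^sup>2)"
    for c :: "'k \<Rightarrow> nat \<Rightarrow> int"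
  define Q where "Q = (\<Prod>j = 1..<n. (cmod (1 - unity_root n j))\<^sup>2)"
  have "Q > 0"
    using n unity_root_eq_iff[of _ n 0] by (auto simp: Q_def intro!: prod_pos)
  have eval: "of_nat n * Determinant.det (Matrix.mat n n (\<lambda>(i, j). \<Sum>x\<in>S. w x * of_int (V c x i) * of_int (V c x j)))
      = Q * P c" for c
  proof -
    have "(\<Sum>x\<in>S. w x * of_int (V c x i) * of_int (V c x j)) =
        (\<Sum>k\<in>I. \<Sum>s<n. t k * of_int (circ n (N k) (diff_coeff (N k) (c k)) s i)
           * of_int (circ n (N k) (diff_coeff (N k) (c k)) s j)) + of_bool (i = 0 \<and> j = 0)" for i j
      unfolding S_def using I
      by (subst sum.insert) (auto simp: sum.reindex sum.cartesian_product w_def V_def intro!: sum.cong)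
    moreover have "(\<Sum>m\<le>N k. diff_coeff (N k) (c k) m) = 0" for k
      using sum_diff_coeff[where z = 1 and 'a = int and N = "N k" and c = "c k"] by simp
    ultimately have "of_nat n * Determinant.det (Matrix.mat n n (\<lambda>(i, j). \<Sum>x\<in>S. w x * of_int (V c x i) * of_int (V c x j)))
      = (\<Prod>j = 1..<n. \<Sum>k\<in>I. t k * (cmod (\<Sum>m\<le>N k. of_int (diff_coeff (N k) (c k) m) * unity_root n j ^ m))\<^sup>2)"
      by (simp only: det_grounded_circulant_gram[OF n])
    also have "\<dots> = Q * P c"
      unfolding Q_def P_def prod.distrib[symmetric] sum_diff_coeff
      by (simp add: norm_mult power_mult_distrib) (simp add: sum_distrib_left mult_ac)
    finally show ?thesis .
  qed
  have "Determinant.det (Matrix.mat n n (\<lambda>(i, j). \<Sum>x\<in>S. w x * of_int (V (\<lambda>_ _. 1) x i) * of_int (V (\<lambda>_ _. 1) x j)))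
      \<le> Determinant.det (Matrix.mat n n (\<lambda>(i, j). \<Sum>x\<in>S. w x * of_int (V c x i) * of_int (V c x j)))"
  proof (rule det_weighted_gram_mono)
    show "finite S" "\<And>x. x \<in> S \<Longrightarrow> w x \<ge> 0"
      using I t by (auto simp: S_def w_def)
  next
    fix x assume "x \<in> S"
    then consider "x = None" | k s where "x = Some (k, s)" "k \<in> I"
      by (auto simp: S_def)
    then show "\<exists>a b. \<forall>j<n. V (\<lambda>_ _. 1) x j = of_bool (j = a) - of_bool (j = b)"
    proof cases
      case 1
      \<comment> \<open>Index \<open>n\<close> lies outside the columns, so the negative entry is
        absent.\<close>
      have "\<forall>j<n. V (\<lambda>_ _. 1) x j = of_bool (j = 0) - of_bool (j = n)"
        using 1 by (auto simp: V_def)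
      then show ?thesis by blast
    next
      case 2
      have "\<forall>j<n. V (\<lambda>_ _. 1) x j = of_bool (j = s mod n) - of_bool (j = (s + N k) mod n)"
        using 2 N by (simp add: V_def circ_diff_coeff_one)
      then show ?thesis by blast
    qed
  next
    fix x j assume "x \<in> S"
    then consider "x = None" | k s where "x = Some (k, s)" "k \<in> I"
      by (auto simp: S_def)
    then show "[V (\<lambda>_ _. 1) x j = V c x j] (mod 2)"
    proof cases
      case 2
      have odd_cong: "[1 = c k m] (mod 2)" if "m < N k" for m
        using c[OF \<open>k \<in> I\<close> that] by (simp add: cong_def odd_iff_mod_2_eq_one)
      have "[diff_coeff (N k) (\<lambda>_. 1) m = diff_coeff (N k) (c k) m] (mod 2)" if "m \<le> N k" for m
        unfolding diff_coeff_def using that by (intro cong_diff) (auto intro!: odd_cong)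
      then show ?thesis
        unfolding V_def 2 option.case prod.case by (rule circ_cong)
    qed (simp add: V_def)
  qed
  then have "Q * P (\<lambda>_ _. 1) \<le> Q * P c"
    unfolding eval[symmetric] using n by simp
  with \<open>Q > 0\<close> show ?thesis
    by (simp add: P_def)
qed

section \<open>Integrals of logarithms\<close>

text \<open>Uniform continuity bounds the error on each cell of length \<open>T / n\<close> by
  \<open>e\<close> times that length, and the cells are added up by induction.\<close>

lemma left_riemann_sums_tendsto:
  fixes F :: "real \<Rightarrow> real" and T :: real
  assumes cont: "continuous_on {0..T} F" and T: "T > 0"
  shows "(\<lambda>n::nat. T / real n * (\<Sum>j<n. F (T * real j / real n))) \<longlonglongrightarrow> integral {0..T} F"
proof (rule LIMSEQ_I)
  fix \<epsilon> :: real assume \<epsilon>: "\<epsilon> > 0"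
  \<comment> \<open>The total error is then at most \<open>T * e = \<epsilon> / 2\<close>, strictly
    below \<epsilon>.\<close>
  define e where "e = \<epsilon> / (2 * T)"
  have e: "e > 0"
    using \<epsilon> T by (simp add: e_def)
  have "uniformly_continuous_on {0..T} F"
    using cont by (intro compact_uniformly_continuous) auto
  then obtain \<delta> where \<delta>: "\<delta> > 0"
    and unif: "\<And>x y. x \<in> {0..T} \<Longrightarrow> y \<in> {0..T} \<Longrightarrow> dist y x < \<delta> \<Longrightarrow> dist (F y) (F x) < e"
    using e unfolding uniformly_continuous_on_def by metis
  obtain n0 :: nat where n0: "T / \<delta> < n0"
    using reals_Archimedean2 by blast
  show "\<exists>n0. \<forall>n\<ge>n0. norm (T / real n * (\<Sum>j<n. F (T * real j / real n)) - integral {0..T} F) < \<epsilon>"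
  proof (intro exI allI impI)
    fix n :: nat assume n: "n \<ge> Suc n0"
    define h where "h = T / n"
    have h: "h > 0" and nh: "real n * h = T"
      using n T by (auto simp: h_def)
    have "T / \<delta> < n"
      using n n0 by linarith
    then have hd: "h < \<delta>"
      using \<delta> n by (simp add: h_def field_simps)
    have "\<bar>h * (\<Sum>j<m. F (real j * h)) - integral {0..real m * h} F\<bar> \<le> real m * h * e" if "m \<le> n" for m
      using that
    proof (induction m)
      case (Suc m)
      have "real (Suc m) * h \<le> real n * h"
        using Suc.prems h by (intro mult_right_mono) auto
      then have sub: "real (Suc m) * h \<le> T"
        using nh by simp
      have split: "real m * h + h = real (Suc m) * h" "0 \<le> real m * h"
        using h by (auto simp: algebra_simps)
      have cont': "continuous_on {real m * h..real (Suc m) * h} F"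
        using split sub by (intro continuous_on_subset[OF cont]) auto
      have "integral {0..real m * h} F + integral {real m * h..real (Suc m) * h} F = integral {0..real (Suc m) * h} F"
        using split sub h
        by (intro Henstock_Kurzweil_Integration.integral_combine integrable_continuous_interval
            continuous_on_subset[OF cont]) auto
      moreover have "norm (integral {real m * h..real (Suc m) * h} (\<lambda>x. F x - F (real m * h))) \<le> e * (real (Suc m) * h - real m * h)"
      proof (rule integral_bound)
        fix x assume x: "x \<in> {real m * h..real (Suc m) * h}"
        then have "0 \<le> x"
          using split(2) by (meson atLeastAtMost_iff order_trans)
        then have "x \<in> {0..T}" "real m * h \<in> {0..T}" "dist x (real m * h) < \<delta>"
          using x split sub hd h unfolding dist_real_def atLeastAtMost_iff by linarith+
        then have "dist (F x) (F (real m * h)) < e"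
          by (intro unif)
        then show "norm (F x - F (real m * h)) \<le> e"
          by (simp add: dist_norm)
      qed (use split h cont' in \<open>auto intro!: continuous_intros\<close>)
      moreover have "integral {real m * h..real (Suc m) * h} (\<lambda>x. F x - F (real m * h)) = integral {real m * h..real (Suc m) * h} F - h * F (real m * h)"
        using integrable_continuous_interval[OF cont'] split(1) h
        by (subst Henstock_Kurzweil_Integration.integral_diff) (auto simp: algebra_simps)
      ultimately show ?case
        using Suc by (simp add: algebra_simps)
    qed simp
    from this[OF order_refl] have "\<bar>h * (\<Sum>j<n. F (real j * h)) - integral {0..T} F\<bar> \<le> T * e"
      by (simp only: nh)
    also have "T * e < \<epsilon>"
      using T \<epsilon> by (simp add: e_def)
    finally show "norm (T / real n * (\<Sum>j<n. F (T * real j / real n)) - integral {0..T} F) < \<epsilon>"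
      by (simp add: h_def mult.commute)
  qed
qed

text \<open>The term \<open>j = 0\<close> of the Riemann sum equals \<open>T * G 0 / r q\<close> and
  tends to \<open>0\<close>, so the trivial root \<open>1\<close>, absent from the products over
  roots of unity, may be ignored. The subsequence \<open>r\<close> allows a restricted set of sample
  counts.\<close>

lemma integral_nonneg_if_nonzero_samples_nonneg:
  fixes G :: "real \<Rightarrow> real" and T :: real and r :: "nat \<Rightarrow> nat"
  assumes cont: "continuous_on {0..T} G" and T: "T > 0" and r: "strict_mono r"
    and samples: "\<And>q. q > 0 \<Longrightarrow> (\<Sum>j = 1..<r q. G (T * real j / real (r q))) \<ge> 0"
  shows "integral {0..T} G \<ge> 0"
proof -
  have "(\<lambda>q. T / real (r q) * (\<Sum>j<r q. G (T * real j / real (r q)))) \<longlonglongrightarrow> integral {0..T} G"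
    using LIMSEQ_subseq_LIMSEQ[OF left_riemann_sums_tendsto[OF cont T] r] by (simp add: o_def)
  moreover have "(\<lambda>q. T * G 0 * (1 / real (r q))) \<longlonglongrightarrow> T * G 0 * 0"
    using LIMSEQ_subseq_LIMSEQ[OF lim_1_over_n r] by (intro tendsto_intros) (simp add: o_def)
  moreover have "\<forall>q\<ge>1. T * G 0 * (1 / real (r q)) \<le> T / real (r q) * (\<Sum>j<r q. G (T * real j / real (r q)))"
  proof (intro allI impI)
    fix q :: nat assume q: "q \<ge> 1"
    then have "r q > 0"
      using strict_monoD[OF r, of 0 q] by simp
    then have "(\<Sum>j<r q. G (T * real j / real (r q))) = G 0 + (\<Sum>j = 1..<r q. G (T * real j / real (r q)))"
      by (simp add: lessThan_atLeast0 sum.atLeast_Suc_lessThan)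
    with samples[of q] q have "G 0 \<le> (\<Sum>j<r q. G (T * real j / real (r q)))"
      by simp
    then have "T / real (r q) * G 0 \<le> T / real (r q) * (\<Sum>j<r q. G (T * real j / real (r q)))"
      using T by (intro mult_left_mono) auto
    then show "T * G 0 * (1 / real (r q)) \<le> T / real (r q) * (\<Sum>j<r q. G (T * real j / real (r q)))"
      by simp
  qed
  ultimately show ?thesis
    using LIMSEQ_le[of _ "T * G 0 * 0" _ "integral {0..T} G"] by (simp only: mult_zero_right) blast
qed

text \<open>For \<open>N\<close> coprime to \<open>n\<close>, taking \<open>N\<close>-th powers
  permutes the nontrivial \<open>n\<close>-th roots of unity, so numerators and denominators of
  \<open>|1 - z ^ N| / |1 - z|\<close> have the same product.\<close>

lemma prod_unity_roots_all_ones: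
  assumes "N \<ge> 1" and n: "n > 0" and "coprime N n"
  shows "(\<Prod>j = 1..<n. cmod (\<Sum>m<N. unity_root n j ^ m)) = 1"
proof -
  define Q where "Q = (\<Prod>j = 1..<n. cmod (1 - unity_root n j))"
  have "Q > 0"
    using n unity_root_eq_iff[of _ n 0] by (auto simp: Q_def intro!: prod_pos)
  have bij: "bij_betw (\<lambda>j. (j * N) mod n) {1..<n} {1..<n}"
    unfolding bij_betw_def
  proof (intro conjI endo_inj_surj)
    show "inj_on (\<lambda>j. (j * N) mod n) {1..<n}"
      using \<open>coprime N n\<close> by (auto simp: inj_on_def cong_mult_rcancel_nat simp flip: cong_def) (simp add: cong_def)
    then show "inj_on (\<lambda>j. (j * N) mod n) {1..<n}" .
    show "(\<lambda>j. (j * N) mod n) ` {1..<n} \<subseteq> {1..<n}"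
    proof clarify
      fix j assume j: "j \<in> {1..<n}"
      have "\<not> n dvd j * N"
        using j \<open>coprime N n\<close> nat_dvd_not_less[of j n]
        by (auto simp: coprime_dvd_mult_left_iff coprime_commute)
      then show "(j * N) mod n \<in> {1..<n}"
        using n by (simp add: mod_greater_zero_iff_not_dvd Suc_le_eq)
    qed
  qed auto
  have root: "unity_root n j ^ N = unity_root n ((j * N) mod n)" for j
  proof -
    have pow: "unity_root n i = unity_root n 1 ^ i" for i
      by (simp add: unity_root_def Complex.DeMoivre mult_ac)
    have "unity_root n 1 ^ (j * N) = unity_root n 1 ^ ((j * N) mod n)"
      using unity_root_power_n[OF n, of 1]
      by (metis div_mult_mod_eq mult.commute mult_1 power_add power_mult power_one)
    then show ?thesis
      by (simp add: pow[of j] pow[of "(j * N) mod n"] power_mult)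
  qed
  have "Q * (\<Prod>j = 1..<n. cmod (\<Sum>m<N. unity_root n j ^ m)) = (\<Prod>j = 1..<n. cmod (1 - unity_root n j ^ N))"
    unfolding Q_def prod.distrib[symmetric] norm_mult[symmetric]
    by (simp only: one_diff_power_eq)
  also have "\<dots> = Q"
    unfolding root Q_def by (rule prod.reindex_bij_betw[OF bij])
  finally show ?thesis
    using \<open>Q > 0\<close> by simp
qed

lemma ln_prod_real:
  fixes f :: "'a \<Rightarrow> real"
  assumes "\<And>x. x \<in> A \<Longrightarrow> f x > 0"
  shows "ln (prod f A) = (\<Sum>x\<in>A. ln (f x))"
proof (cases "finite A")
  case True
  then show ?thesis
    using assms by (intro ln_prod) (auto dest: less_imp_neq[THEN not_sym])
qed simp

text \<open>The index \<open>k0\<close> carries a constant polynomial with an odd, hence nonzero,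
  coefficient, so both sums are positive everywhere and their logarithms continuous. The inequality
  for products over roots of unity then passes to the integrals through Riemann sums.\<close>

lemma integral_ln_mono_positive:
  fixes t :: "'k \<Rightarrow> real" and N :: "'k \<Rightarrow> nat" and c :: "'k \<Rightarrow> nat \<Rightarrow> int"
  assumes I: "finite I"
    and t: "\<And>k. k \<in> I \<Longrightarrow> t k > 0" and N: "\<And>k. k \<in> I \<Longrightarrow> N k \<ge> 1"
    and c: "\<And>k m. k \<in> I \<Longrightarrow> m < N k \<Longrightarrow> odd (c k m)"
    and unit: "k0 \<in> I" "N k0 = 1"
  shows "integral {0..2*pi} (\<lambda>\<theta>. ln (\<Sum>k\<in>I. t k * (cmod (\<Sum>m<N k. cis \<theta> ^ m))\<^sup>2))
       \<le> integral {0..2*pi} (\<lambda>\<theta>. ln (\<Sum>k\<in>I. t k * (cmod (\<Sum>m<N k. of_int (c k m) * cis \<theta> ^ m))\<^sup>2))"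
proof -
  define W where "W c \<theta> = (\<Sum>k\<in>I. t k * (cmod (\<Sum>m<N k. of_int (c k m) * cis \<theta> ^ m))\<^sup>2)"
    for c :: "'k \<Rightarrow> nat \<Rightarrow> int" and \<theta>
  have W_pos: "W c \<theta> > 0" if "odd (c k0 0)" for c \<theta>
  proof -
    have "c k0 0 \<noteq> 0"
      using that by auto
    then have "0 < t k0 * (cmod (\<Sum>m<N k0. of_int (c k0 m) * cis \<theta> ^ m))\<^sup>2"
      using t[OF unit(1)] unit(2) by simp
    also have "\<dots> \<le> W c \<theta>"
      unfolding W_def using I unit(1) less_imp_le[OF t] by (intro member_le_sum) auto
    finally show ?thesis .
  qed
  have pos: "W c \<theta> > 0" "W (\<lambda>_ _. 1) \<theta> > 0" for \<theta>
    using c[OF unit(1), of 0] unit(2) by (auto intro: W_pos)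
  have cont: "continuous_on A (\<lambda>\<theta>. ln (W c \<theta>))" "continuous_on A (\<lambda>\<theta>. ln (W (\<lambda>_ _. 1) \<theta>))" for A
    using pos less_imp_neq[OF pos(1)] less_imp_neq[OF pos(2)]
    unfolding W_def by (auto intro!: continuous_intros)
  have "integral {0..2*pi} (\<lambda>\<theta>. ln (W c \<theta>) - ln (W (\<lambda>_ _. 1) \<theta>)) \<ge> 0"
  proof (rule integral_nonneg_if_nonzero_samples_nonneg)
    show "strict_mono Suc"
      by (simp add: strict_mono_Suc_iff)
    fix q :: nat
    have "(\<Prod>j = 1..<Suc q. W (\<lambda>_ _. 1) (2*pi * real j / real (Suc q))) \<le> (\<Prod>j = 1..<Suc q. W c (2*pi * real j / real (Suc q)))"
      using prod_unity_roots_mono[of "Suc q" I t N c] I less_imp_le[OF t] N c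
      by (simp add: W_def unity_root_def del: of_nat_Suc)
    then have "ln (\<Prod>j = 1..<Suc q. W (\<lambda>_ _. 1) (2*pi * real j / real (Suc q))) \<le> ln (\<Prod>j = 1..<Suc q. W c (2*pi * real j / real (Suc q)))"
      using pos by (subst ln_le_cancel_iff) (auto intro!: prod_pos simp del: prod.op_ivl_Suc of_nat_Suc)
    then show "(\<Sum>j = 1..<Suc q. ln (W c (2*pi * real j / real (Suc q))) - ln (W (\<lambda>_ _. 1) (2*pi * real j / real (Suc q)))) \<ge> 0"
      unfolding ln_prod_real[OF pos(1)] ln_prod_real[OF pos(2)] sum_subtractf by simp
  qed (auto intro!: continuous_on_diff cont)
  also have "integral {0..2*pi} (\<lambda>\<theta>. ln (W c \<theta>) - ln (W (\<lambda>_ _. 1) \<theta>)) =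
      integral {0..2*pi} (\<lambda>\<theta>. ln (W c \<theta>)) - integral {0..2*pi} (\<lambda>\<theta>. ln (W (\<lambda>_ _. 1) \<theta>))"
    by (intro Henstock_Kurzweil_Integration.integral_diff integrable_continuous_interval cont)
  finally show ?thesis
    by (simp add: W_def)
qed

text \<open>
  Sampling along \<open>n = N q + 1\<close> keeps \<open>n\<close> coprime to \<open>N\<close>, where the product of \<open>|D N|\<close> is exactly 1.
\<close>

lemma integral_ln_all_ones_ge:
  assumes N: "N \<ge> 1" and "a > 0" and cont: "continuous_on {0..2*pi} W"
    and pos: "\<And>\<theta>. W \<theta> > 0" and W: "\<And>\<theta>. a * (cmod (\<Sum>m<N. cis \<theta> ^ m))\<^sup>2 \<le> W \<theta>"
  shows "2 * pi * ln a \<le> integral {0..2*pi} (\<lambda>\<theta>. ln (W \<theta>))"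
proof -
  have cont': "continuous_on {0..2*pi} (\<lambda>\<theta>. ln (W \<theta>))"
    using cont less_imp_neq[OF pos] pos by (auto intro!: continuous_intros)
  have "integral {0..2*pi} (\<lambda>\<theta>. ln (W \<theta>) - ln a) \<ge> 0"
  proof (rule integral_nonneg_if_nonzero_samples_nonneg)
    show "strict_mono (\<lambda>q. N * q + 1)"
      using N by (simp add: strict_mono_def)
    fix q :: nat
    define n where "n = N * q + 1"
    have "coprime N n"
      unfolding n_def by (metis add.commute coprime_1_right gcd_add_mult coprime_iff_gcd_eq_1 mult.commute)
    then have one: "(\<Prod>j = 1..<n. cmod (\<Sum>m<N. unity_root n j ^ m)) = 1"
      using N by (intro prod_unity_roots_all_ones) (auto simp: n_def)
    \<comment> \<open>Each of the \<open>n - 1\<close> nontrivial roots contributes a factor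
      \<open>a\<close>, and the moduli multiply to \<open>1\<close>.\<close>
    have "a ^ (n - 1) = (\<Prod>j = 1..<n. a * (cmod (\<Sum>m<N. unity_root n j ^ m))\<^sup>2)"
      unfolding prod.distrib prod_power_distrib[symmetric] one by simp
    also have "\<dots> \<le> (\<Prod>j = 1..<n. W (2*pi * real j / real n))"
      using W \<open>a > 0\<close> by (intro prod_mono) (auto simp: unity_root_def)
    finally have "ln (a ^ (n - 1)) \<le> ln (\<Prod>j = 1..<n. W (2*pi * real j / real n))"
      using pos \<open>a > 0\<close> by (subst ln_le_cancel_iff) (auto intro!: prod_pos)
    then have "(n - 1) * ln a \<le> (\<Sum>j = 1..<n. ln (W (2*pi * real j / real n)))"
      unfolding ln_prod_real[OF pos] using \<open>a > 0\<close> by (simp add: ln_realpow)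
    then show "(\<Sum>j = 1..<n. ln (W (2*pi * real j / real n)) - ln a) \<ge> 0"
      by (simp add: sum_subtractf)
  qed (auto intro!: continuous_on_diff cont' continuous_intros)
  also have "integral {0..2*pi} (\<lambda>\<theta>. ln (W \<theta>) - ln a) = integral {0..2*pi} (\<lambda>\<theta>. ln (W \<theta>)) - 2 * pi * ln a"
    using integrable_continuous_interval[OF cont']
    by (subst Henstock_Kurzweil_Integration.integral_diff) auto
  finally show ?thesis by simp
qed

section \<open>Removing the perturbation\<close>

text \<open>The perturbed logarithms decrease in \<open>m\<close>, and \<open>C\<close> keeps their
  integrals from diverging to minus infinity; otherwise \<open>ln (W x)\<close> would not be
  integrable and its integral would take the default value \<open>0\<close>. At zeros of
  \<open>W\<close> the logarithms diverge while \<open>ln 0\<close> is a real number, so these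
  points must form a null set.\<close>

lemma integral_ln_perturbed_tendsto:
  fixes W :: "real \<Rightarrow> real"
  assumes cont: "continuous_on UNIV W" and nonneg: "\<And>x. W x \<ge> 0"
    and fin: "finite {x \<in> {a..b}. W x = 0}"
    and bound: "\<And>m. C \<le> integral {a..b} (\<lambda>x. ln (W x + 1 / real (Suc m)))"
  shows "(\<lambda>m. integral {a..b} (\<lambda>x. ln (W x + 1 / real (Suc m)))) \<longlonglongrightarrow> (LBINT x:{a..b}. ln (W x))"
proof -
  define F where "F = (\<lambda>m x. ln (W x + 1 / real (Suc m)))"
  \<comment> \<open>The sign makes the sequence increasing, as monotone convergence
    requires.\<close>
  define f where "f = (\<lambda>m x. - (indicator {a..b} x * F m x))"
  have pos: "W x + 1 / real (Suc m) > 0" for m x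
    using nonneg[of x] by (intro add_nonneg_pos) auto
  have F_int: "set_integrable lborel {a..b} (F m)" for m
    unfolding F_def using pos[of _ m] less_imp_neq[OF pos[of _ m]] continuous_on_subset[OF cont]
    by (intro borel_integrable_atLeastAtMost' continuous_intros) auto
  have F_mono: "F m' x \<le> F m x" if "m \<le> m'" for m m' x
    unfolding F_def using pos that by (subst ln_le_cancel_iff) (auto simp: field_simps)
  have f_int: "integrable lborel (f m)" for m
    using F_int[of m] by (simp add: f_def set_integrable_def)
  have f_integral: "integral\<^sup>L lborel (f m) = - integral {a..b} (F m)" for m
    using set_borel_integral_eq_integral(2)[OF F_int[of m]]
    by (simp add: f_def set_lebesgue_integral_def)
  have "decseq (\<lambda>m. integral {a..b} (F m))"
    unfolding decseq_def using set_borel_integral_eq_integral(1)[OF F_int] F_mono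
    by (auto intro!: Henstock_Kurzweil_Integration.integral_le)
  moreover have "\<forall>m. C \<le> integral {a..b} (F m)"
    unfolding F_def by (intro allI bound)
  ultimately obtain L where L: "(\<lambda>m. integral {a..b} (F m)) \<longlonglongrightarrow> L"
    by (rule decseq_convergent)
  have W_meas: "W \<in> borel_measurable borel"
    using cont by (rule borel_measurable_continuous_onI)
  have "integral\<^sup>L lborel (\<lambda>x. - (indicator {a..b} x * ln (W x))) = - L"
  proof (rule integral_monotone_convergence[where f = f])
    show "AE x in lborel. mono (\<lambda>n. f n x)"
      by (auto simp: f_def mono_def intro!: mult_left_mono F_mono)
    have "AE x in lborel. x \<notin> {x \<in> {a..b}. W x = 0}"
      using fin by (intro AE_not_in finite_imp_null_set_lborel)
    then show "AE x in lborel. (\<lambda>i. f i x) \<longlonglongrightarrow> - (indicator {a..b} x * ln (W x))"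
    proof eventually_elim
      case (elim x)
      show ?case
      proof (cases "x \<in> {a..b}")
        case True
        with elim have "W x \<noteq> 0" by auto
        have "(\<lambda>m. W x + 1 / real (Suc m)) \<longlonglongrightarrow> W x + 0"
          by (intro tendsto_intros LIMSEQ_Suc[OF lim_1_over_n])
        then have "(\<lambda>m. F m x) \<longlonglongrightarrow> ln (W x)"
          unfolding F_def using \<open>W x \<noteq> 0\<close> by (intro tendsto_ln) auto
        then show ?thesis
          unfolding f_def by (intro tendsto_intros)
      qed (simp add: f_def)
    qed
    show "(\<lambda>i. integral\<^sup>L lborel (f i)) \<longlonglongrightarrow> - L"
      unfolding f_integral using L by (rule tendsto_minus)
    show "(\<lambda>x. - (indicator {a..b} x * ln (W x))) \<in> borel_measurable lborel"
      using W_meas by measurable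
  qed (rule f_int)
  with L show ?thesis
    by (simp add: F_def set_lebesgue_integral_def)
qed

text \<open>There are finitely many roots, and \<open>cis\<close> is injective on the half-open
  interval, so only finitely many angles lie over them.\<close>

lemma finite_zeros_poly_cis:
  assumes "p \<noteq> (0 :: complex poly)"
  shows "finite {\<theta> \<in> {0..2*pi}. poly p (cis \<theta>) = 0}"
proof -
  have "inj_on cis {0..<2*pi}"
  proof (rule inj_onI)
    fix x y assume "x \<in> {0..<2*pi}" "y \<in> {0..<2*pi}" "cis x = cis y"
    then have "\<bar>x - y\<bar> < 2 * pi" and eq: "exp (\<i> * complex_of_real x) = exp (\<i> * complex_of_real y)"
      by (simp_all only: cis_conv_exp atLeastLessThan_iff) linarith
    then have "\<bar>Im (\<i> * complex_of_real x) - Im (\<i> * complex_of_real y)\<bar> < 2 * pi"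
      by (simp only: Im_i_times Re_complex_of_real)
    then have "\<i> * complex_of_real x = \<i> * complex_of_real y"
      using eq by (rule exp_complex_eqI)
    then show "x = y" by simp
  qed
  then have "finite (cis -` {z. poly p z = 0} \<inter> {0..<2*pi})"
    by (rule finite_vimage_IntI[OF poly_roots_finite[OF assms]])
  \<comment> \<open>The endpoint left out for the sake of injectivity is put back.\<close>
  then have "finite (insert (2*pi) (cis -` {z. poly p z = 0} \<inter> {0..<2*pi}))"
    by simp
  then show ?thesis
    by (rule finite_subset[rotated]) auto
qed

section \<open>Littlewood polynomials\<close>

lemma littlewood_int_coeffs:
  assumes "f \<in> littlewood N"
  obtains c :: "nat \<Rightarrow> int"
  where "\<And>m. odd (c m)" "\<And>z. poly f z = (\<Sum>m<N. of_int (c m) * z ^ m)"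
proof -
  obtain c where f: "f = (\<Sum>j<N. monom (c j) j)" and c: "\<forall>j<N. c j \<in> {1, -1 :: complex}"
    using assms unfolding littlewood_def by auto
  \<comment> \<open>Indices from \<open>N\<close> on also receive \<open>1\<close> or
    \<open>-1\<close>, so oddness holds for every \<open>m\<close>.\<close>
  define d where "d m = (if c m = 1 then 1 else - 1 :: int)" for m
  have "poly f z = (\<Sum>m<N. of_int (d m) * z ^ m)" for z
    unfolding f poly_sum poly_monom using c by (intro sum.cong) (auto simp: d_def)
  moreover have "odd (d m)" for m
    by (simp add: d_def)
  ultimately show ?thesis
    using that by blast
qed

lemma poly_D: "poly (D N) z = (\<Sum>m<N. z ^ m)"
  by (simp add: D_def poly_sum poly_monom)

lemma D_in_littlewood: "D N \<in> littlewood N"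
  unfolding D_def littlewood_def by (auto intro!: exI[of _ "\<lambda>_. 1"])

section \<open>The perturbed inequality and the passage to the limit\<close>

definition weighted_square_sum :: "nat \<Rightarrow> (nat \<Rightarrow> real) \<Rightarrow> (nat \<Rightarrow> complex poly) \<Rightarrow> real \<Rightarrow> real" where
  "weighted_square_sum K t f \<theta> = (\<Sum>k=1..K. t k * (cmod (poly (f k) (cis \<theta>)))\<^sup>2)"

lemma continuous_on_weighted_square_sum: "continuous_on A (weighted_square_sum K t f)"
  unfolding weighted_square_sum_def by (intro continuous_intros)

lemma weighted_square_sum_nonneg:
  "(\<And>k. k \<in> {1..K} \<Longrightarrow> t k > 0) \<Longrightarrow> weighted_square_sum K t f \<theta> \<ge> 0"
  unfolding weighted_square_sum_def by (intro sum_nonneg mult_nonneg_nonneg) (auto intro: less_imp_le)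

lemma integral_ln_perturbed_mono:
  assumes N: "\<And>k. k \<in> {1..K} \<Longrightarrow> N k \<ge> 1"
    and f: "\<And>k. k \<in> {1..K} \<Longrightarrow> f k \<in> littlewood (N k)"
    and t: "\<And>k. k \<in> {1..K} \<Longrightarrow> t k > 0" and e: "e > 0"
  shows "integral {0..2*pi} (\<lambda>\<theta>. ln (weighted_square_sum K t (\<lambda>k. D (N k)) \<theta> + e))
       \<le> integral {0..2*pi} (\<lambda>\<theta>. ln (weighted_square_sum K t f \<theta> + e))"
proof -
  have "\<exists>c. (\<forall>m. odd (c m)) \<and> (\<forall>z. poly (f k) z = (\<Sum>m<N k. of_int (c m :: int) * z ^ m))"
    if "k \<in> {1..K}" for k
    by (rule littlewood_int_coeffs[OF f[OF that]]) blast
  then obtain c where c: "\<And>k m. k \<in> {1..K} \<Longrightarrow> odd (c k m :: int)"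
    and fc: "\<And>k z. k \<in> {1..K} \<Longrightarrow> poly (f k) z = (\<Sum>m<N k. of_int (c k m) * z ^ m)"
    by metis
  \<comment> \<open>the perturbation \<open>e\<close> is the term of an additional index 0 with \<open>D 1\<close>\<close>
  define t' where "t' = t(0 := e)"
  define N' where "N' = N(0 := 1)"
  define c' where "c' = c(0 := (\<lambda>_. 1))"
  have "integral {0..2*pi} (\<lambda>\<theta>. ln (\<Sum>k\<in>{0..K}. t' k * (cmod (\<Sum>m<N' k. cis \<theta> ^ m))\<^sup>2))
      \<le> integral {0..2*pi} (\<lambda>\<theta>. ln (\<Sum>k\<in>{0..K}. t' k * (cmod (\<Sum>m<N' k. of_int (c' k m) * cis \<theta> ^ m))\<^sup>2))"
    by (rule integral_ln_mono_positive[where ?k0.0 = 0])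
      (use N t e c in \<open>auto simp: t'_def N'_def c'_def\<close>)
  moreover have "(\<Sum>k\<in>{0..K}. t' k * (cmod (\<Sum>m<N' k. cis \<theta> ^ m))\<^sup>2) =
      weighted_square_sum K t (\<lambda>k. D (N k)) \<theta> + e" for \<theta>
    unfolding weighted_square_sum_def
    by (subst sum.atLeast_Suc_atMost) (auto simp: t'_def N'_def poly_D add.commute)
  moreover have "(\<Sum>k\<in>{0..K}. t' k * (cmod (\<Sum>m<N' k. of_int (c' k m) * cis \<theta> ^ m))\<^sup>2) =
      weighted_square_sum K t f \<theta> + e" for \<theta>
    unfolding weighted_square_sum_def
    by (subst sum.atLeast_Suc_atMost) (auto simp: t'_def N'_def c'_def fc add.commute)
  ultimately show ?thesis by simp
qed

text \<open>The sum vanishes only at zeros of \<open>f 1\<close>, a nonzero polynomial, hence at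
  finitely many angles. The lower bound needed for convergence is known for the all-ones polynomials
  and is carried over to \<open>f\<close> by the perturbed inequality.\<close>

lemma integral_ln_weighted_square_sum_tendsto:
  assumes K: "K \<ge> 1"
    and N: "\<And>k. k \<in> {1..K} \<Longrightarrow> N k \<ge> 1"
    and f: "\<And>k. k \<in> {1..K} \<Longrightarrow> f k \<in> littlewood (N k)"
    and t: "\<And>k. k \<in> {1..K} \<Longrightarrow> t k > 0"
  shows "(\<lambda>m. integral {0..2*pi} (\<lambda>\<theta>. ln (weighted_square_sum K t f \<theta> + 1 / real (Suc m))))
    \<longlonglongrightarrow> (LBINT \<theta>:{0..2*pi}. ln (weighted_square_sum K t f \<theta>))"
proof (rule integral_ln_perturbed_tendsto)
  have first: "t 1 * (cmod (poly (g 1) (cis \<theta>)))\<^sup>2 \<le> weighted_square_sum K t g \<theta>" for g \<theta>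
  proof -
    have "0 \<le> t k * (cmod (poly (g k) (cis \<theta>)))\<^sup>2" if "k \<in> {1..K}" for k
      using t[OF that] by simp
    then show ?thesis
      unfolding weighted_square_sum_def using K by (intro member_le_sum) simp_all
  qed
  have "f 1 \<noteq> 0"
  proof
    assume "f 1 = 0"
    have "f 1 \<in> littlewood (N 1)"
      using f K by simp
    then obtain c where c: "\<And>m. odd (c m :: int)" and fc: "\<And>z. poly (f 1) z = (\<Sum>m<N 1. of_int (c m) * z ^ m)"
      by (rule littlewood_int_coeffs) blast
    \<comment> \<open>At \<open>0\<close> only the constant coefficient survives; it is present
      since \<open>N 1 \<ge> 1\<close>, and it is odd.\<close>
    have "poly (f 1) 0 = (\<Sum>m\<in>{0}. of_int (c m) * 0 ^ m)"
      unfolding fc using N[of 1] K by (intro sum.mono_neutral_right) auto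
    with c[of 0] \<open>f 1 = 0\<close> show False by auto
  qed
  then have "finite {\<theta> \<in> {0..2*pi}. poly (f 1) (cis \<theta>) = 0}"
    by (rule finite_zeros_poly_cis)
  then show "finite {\<theta> \<in> {0..2*pi}. weighted_square_sum K t f \<theta> = 0}"
  proof (rule finite_subset[rotated], intro Collect_mono impI conjI)
    fix \<theta> assume "\<theta> \<in> {0..2*pi} \<and> weighted_square_sum K t f \<theta> = 0"
    with first[of f \<theta>] have "t 1 * (cmod (poly (f 1) (cis \<theta>)))\<^sup>2 \<le> 0"
      by simp
    with t[of 1] K show "poly (f 1) (cis \<theta>) = 0"
      by (simp add: mult_le_0_iff)
  qed auto
  \<comment> \<open>A bound independent of \<open>m\<close>: it comes from the term
    \<open>k = 1\<close> of the all-ones sum alone.\<close>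
  show "2 * pi * ln (t 1) \<le> integral {0..2*pi} (\<lambda>\<theta>. ln (weighted_square_sum K t f \<theta> + 1 / real (Suc m)))" for m
  proof -
    let ?W = "\<lambda>\<theta>. weighted_square_sum K t (\<lambda>k. D (N k)) \<theta> + 1 / real (Suc m)"
    have "2 * pi * ln (t 1) \<le> integral {0..2*pi} (\<lambda>\<theta>. ln (?W \<theta>))"
    proof (rule integral_ln_all_ones_ge)
      show "N 1 \<ge> 1" "t 1 > 0"
        using K N t by auto
      show "continuous_on {0..2*pi} ?W"
        by (intro continuous_intros continuous_on_weighted_square_sum)
      show "?W \<theta> > 0" for \<theta>
        using weighted_square_sum_nonneg[of K t "\<lambda>k. D (N k)" \<theta>] t by (simp add: add_nonneg_pos)
      show "t 1 * (cmod (\<Sum>m<N 1. cis \<theta> ^ m))\<^sup>2 \<le> ?W \<theta>" for \<theta>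
        using first[of "\<lambda>k. D (N k)" \<theta>] by (simp add: poly_D add_increasing2)
    qed
    also have "\<dots> \<le> integral {0..2*pi} (\<lambda>\<theta>. ln (weighted_square_sum K t f \<theta> + 1 / real (Suc m)))"
      by (intro integral_ln_perturbed_mono N f t) auto
    finally show ?thesis .
  qed
  show "weighted_square_sum K t f \<theta> \<ge> 0" for \<theta>
    by (rule weighted_square_sum_nonneg[OF t])
qed (rule continuous_on_weighted_square_sum)

theorem theorem1p1:
  fixes K :: nat and N :: "nat \<Rightarrow> nat"
    and f :: "nat \<Rightarrow> complex poly" and t :: "nat \<Rightarrow> real"
  assumes "K \<ge> 1"
    and "\<And>k. k \<in> {1..K} \<Longrightarrow> N k \<ge> 1"
    and "\<And>k. k \<in> {1..K} \<Longrightarrow> f k \<in> littlewood (N k)"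
    and "\<And>k. k \<in> {1..K} \<Longrightarrow> t k > 0"
  shows "(LBINT \<theta>:{0..2*pi}.
            ln (\<Sum>k=1..K. t k * (cmod (poly (D (N k)) (exp (\<i> * complex_of_real \<theta>))))\<^sup>2))
       \<le> (LBINT \<theta>:{0..2*pi}.
            ln (\<Sum>k=1..K. t k * (cmod (poly (f k) (exp (\<i> * complex_of_real \<theta>))))\<^sup>2))"
proof -
  define W where "W = weighted_square_sum K t"
  define V where "V g = (\<lambda>m. integral {0..2*pi} (\<lambda>\<theta>. ln (W g \<theta> + 1 / real (Suc m))))" for g
  have lim: "V g \<longlonglongrightarrow> (LBINT \<theta>:{0..2*pi}. ln (W g \<theta>))"
    if "\<And>k. k \<in> {1..K} \<Longrightarrow> g k \<in> littlewood (N k)" for g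
    unfolding V_def W_def
    by (intro integral_ln_weighted_square_sum_tendsto[of K N g t] assms(1,2,4) that)
  have "V (\<lambda>k. D (N k)) m \<le> V f m" for m
    unfolding V_def W_def by (intro integral_ln_perturbed_mono[of K N f t] assms(2-4)) simp_all
  moreover have "V (\<lambda>k. D (N k)) \<longlonglongrightarrow> (LBINT \<theta>:{0..2*pi}. ln (W (\<lambda>k. D (N k)) \<theta>))"
    by (rule lim) (rule D_in_littlewood)
  moreover have "V f \<longlonglongrightarrow> (LBINT \<theta>:{0..2*pi}. ln (W f \<theta>))"
    by (rule lim) (rule assms(3))
  ultimately have "(LBINT \<theta>:{0..2*pi}. ln (W (\<lambda>k. D (N k)) \<theta>)) \<le> (LBINT \<theta>:{0..2*pi}. ln (W f \<theta>))"
    by (intro LIMSEQ_le[of "V (\<lambda>k. D (N k))" _ "V f"]) simp_all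
  then show ?thesis
    by (simp only: W_def weighted_square_sum_def cis_conv_exp)
qed

end
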